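(* Let $K$ be a totally real extension of $\mathbb{Q}$ of infinite degree. If $\mathcal{O}_K^+$ has the Northcott property with respect to the house, then there exists no universal quadratic lattice over $K$.
   Context: An algebraic number is totally real (resp. totally positive) if all its conjugates, i.e. all roots of its minimal polynomial over $\mathbb{Q}$, are real (resp. positive real). A totally real extension of $\mathbb{Q}$ is an algebraic extension all of whose elements are totally real. For an algebraic extension $K/\mathbb{Q}$, $\mathcal{O}_K$ is the ring of elements of $K$ integral over $\mathbb{Z}$, and $\mathcal{O}_K^+$ is the set of totally positive elements of $\mathcal{O}_K$. The house of an algebraic number $\alpha$ with conjugates $\alpha_1,\dots,\alpha_n$ is $\max_i|\alpha_i|$. The set $\mathcal{O}_K^+$ has the Northcott property with respect to the house if for every $r\in\mathbb{R}$ there are only finitely many $\alpha\in\mathcal{O}_K^+$ with house less than $r$. Let $K$ be a totally real field. An $\mathcal{O}_K$-lattice is a finitely generated $\mathcal{O}_K$-module $\Lambda\subseteq V$, where $V$ is a finite-dimensional $K$-vector space. A quadratic map on $V$ is a map $Q:V\to K$ with $Q(av)=a^2Q(v)$ for all $a\in K$, $v\in V$, such that $B_Q(v,w)=\frac12(Q(v+w)-Q(v)-Q(w))$ is bilinear. A quadratic lattice over $K$ (quadratic $\mathcal{O}_K$-lattice) is a pair $(\Lambda,Q)$ of an $\mathcal{O}_K$-lattice and the restriction of a quadratic map to $\Lambda$. It is integral if $Q(\Lambda)\subseteq\mathcal{O}_K$; an integral quadratic lattice is positive definite if $Q(v)$ is totally positive for every $0\neq v\in\Lambda$, and universal if it is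 positive definite and for every totally positive $d\in\mathcal{O}_K$ there is $v\in\Lambda$ with $Q(v)=d$. *)

theory Defs
  imports "HOL-Computational_Algebra.Computational_Algebra"
begin

text \<open>
  The field \<open>K\<close> is a type \<open>'k\<close> of class \<open>field_char_0\<close>, viewed as an extension of the rationals
  via \<^const>\<open>of_rat\<close>; no embedding into the real or complex numbers is chosen.  A \<open>K\<close>-vector
  space \<open>V\<close> is a type \<open>'v\<close> together with a scalar multiplication \<open>scale :: 'k \<Rightarrow> 'v \<Rightarrow> 'v\<close>.
\<close>

definition is_min_poly_rat :: "rat poly \<Rightarrow> 'k::field_char_0 \<Rightarrow> bool" where
  "is_min_poly_rat p x \<longleftrightarrow>
     lead_coeff p = 1 \<and> irreducible p \<and> poly (map_poly of_rat p) x = 0"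

text \<open>Unspecified if \<open>x\<close> is transcendental; see \<open>algebraic_ex1_min_poly_rat\<close> below.\<close>

definition min_poly_rat :: "'k::field_char_0 \<Rightarrow> rat poly" where
  "min_poly_rat x = (THE p. is_min_poly_rat p x)"

definition conjugates :: "'k::field_char_0 \<Rightarrow> complex set" where
  "conjugates x = {z. poly (map_poly of_rat (min_poly_rat x)) z = 0}"

definition totally_real :: "'k::field_char_0 \<Rightarrow> bool" where
  "totally_real x \<longleftrightarrow> algebraic x \<and> conjugates x \<subseteq> \<real>"

definition totally_positive :: "'k::field_char_0 \<Rightarrow> bool" where
  "totally_positive x \<longleftrightarrow> algebraic x \<and> (\<forall>z\<in>conjugates x. z \<in> \<real> \<and> Re z > 0)"

definition house :: "'k::field_char_0 \<Rightarrow> real" where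
  "house x = Max (norm ` conjugates x)"

definition ring_of_integers :: "'k::field_char_0 set" where
  "ring_of_integers = {x. algebraic_int x}"

definition totally_positive_integers :: "'k::field_char_0 set" where
  "totally_positive_integers = {x \<in> ring_of_integers. totally_positive x}"

definition northcott_house :: "'k::field_char_0 set \<Rightarrow> bool" where
  "northcott_house A \<longleftrightarrow> (\<forall>r::real. finite {x \<in> A. house x < r})"

definition infinite_degree_over_rat :: "'k::field_char_0 itself \<Rightarrow> bool" where
  "infinite_degree_over_rat _ \<longleftrightarrow>
     \<not> (\<exists>B::'k set. finite B \<and> module.span (\<lambda>(q::rat) (x::'k). of_rat q * x) B = UNIV)"

definition finite_dim_vector_space :: "('k::field \<Rightarrow> 'v::ab_group_add \<Rightarrow> 'v) \<Rightarrow> bool" where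
  "finite_dim_vector_space scale \<longleftrightarrow>
     vector_space scale \<and> (\<exists>B. finite B \<and> module.span scale B = UNIV)"

text \<open>A lattice need not span \<open>V\<close> over \<open>K\<close>.\<close>

definition integer_lattice ::
    "('k::field_char_0 \<Rightarrow> 'v::ab_group_add \<Rightarrow> 'v) \<Rightarrow> 'v set \<Rightarrow> bool" where
  "integer_lattice scale L \<longleftrightarrow>
     0 \<in> L \<and> (\<forall>v\<in>L. \<forall>w\<in>L. v + w \<in> L) \<and> (\<forall>a\<in>ring_of_integers. \<forall>v\<in>L. scale a v \<in> L) \<and>
     (\<exists>S. finite S \<and> S \<subseteq> L \<and>
        (\<forall>v\<in>L. \<exists>c. (\<forall>s\<in>S. c s \<in> ring_of_integers) \<and> v = (\<Sum>s\<in>S. scale (c s) s)))"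

definition polar_form :: "('v::ab_group_add \<Rightarrow> 'k::field_char_0) \<Rightarrow> 'v \<Rightarrow> 'v \<Rightarrow> 'k" where
  "polar_form Q v w = (Q (v + w) - Q v - Q w) / 2"

definition quadratic_map ::
    "('k::field_char_0 \<Rightarrow> 'v::ab_group_add \<Rightarrow> 'v) \<Rightarrow> ('v \<Rightarrow> 'k) \<Rightarrow> bool" where
  "quadratic_map scale Q \<longleftrightarrow>
     (\<forall>a v. Q (scale a v) = a\<^sup>2 * Q v) \<and>
     (\<forall>w. Vector_Spaces.linear scale (*) (\<lambda>v. polar_form Q v w)) \<and>
     (\<forall>v. Vector_Spaces.linear scale (*) (\<lambda>w. polar_form Q v w))"

text \<open>
  The form \<open>q\<close> of a quadratic lattice is only relevant on \<open>L\<close>, where it is the restriction of a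
  quadratic map defined on all of \<open>V\<close>.
\<close>

definition quadratic_lattice ::
    "('k::field_char_0 \<Rightarrow> 'v::ab_group_add \<Rightarrow> 'v) \<Rightarrow> 'v set \<Rightarrow> ('v \<Rightarrow> 'k) \<Rightarrow> bool" where
  "quadratic_lattice scale L q \<longleftrightarrow>
     finite_dim_vector_space scale \<and> integer_lattice scale L \<and>
     (\<exists>Q. quadratic_map scale Q \<and> (\<forall>v\<in>L. q v = Q v))"

definition integral_quadratic_lattice ::
    "('k::field_char_0 \<Rightarrow> 'v::ab_group_add \<Rightarrow> 'v) \<Rightarrow> 'v set \<Rightarrow> ('v \<Rightarrow> 'k) \<Rightarrow> bool" where
  "integral_quadratic_lattice scale L q \<longleftrightarrow>
     quadratic_lattice scale L q \<and> q ` L \<subseteq> ring_of_integers"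

definition positive_definite_lattice ::
    "('k::field_char_0 \<Rightarrow> 'v::ab_group_add \<Rightarrow> 'v) \<Rightarrow> 'v set \<Rightarrow> ('v \<Rightarrow> 'k) \<Rightarrow> bool" where
  "positive_definite_lattice scale L q \<longleftrightarrow>
     integral_quadratic_lattice scale L q \<and> (\<forall>v\<in>L. v \<noteq> 0 \<longrightarrow> totally_positive (q v))"

definition universal_quadratic_lattice ::
    "('k::field_char_0 \<Rightarrow> 'v::ab_group_add \<Rightarrow> 'v) \<Rightarrow> 'v set \<Rightarrow> ('v \<Rightarrow> 'k) \<Rightarrow> bool" where
  "universal_quadratic_lattice scale L q \<longleftrightarrow>
     positive_definite_lattice scale L q \<and>
     (\<forall>d\<in>totally_positive_integers. \<exists>v\<in>L. q v = d)"

lemma algebraic_ex1_min_poly_rat: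
  fixes x :: "'k::field_char_0"
  assumes "algebraic x"
  shows "\<exists>!p. is_min_poly_rat p x"
proof -
  define ev where "ev = (\<lambda>p::rat poly. poly (map_poly of_rat p) x)"
  have ev_0: "ev 0 = 0"
    by (simp add: ev_def)
  have ev_pCons: "ev (pCons a p) = of_rat a + x * ev p" for a p
    by (cases "pCons a p = 0") (auto simp: ev_def map_poly_pCons)
  have ev_const: "ev [:a:] = of_rat a" for a
    by (simp add: ev_pCons ev_0)
  have ev_add: "ev (p + q) = ev p + ev q" for p q
    by (induction p q rule: poly_induct2) (simp_all add: ev_0 ev_pCons of_rat_add algebra_simps)
  have ev_smult: "ev (smult a p) = of_rat a * ev p" for a p
    by (induction p) (simp_all add: ev_0 ev_pCons of_rat_mult algebra_simps)
  have ev_mult: "ev (p * q) = ev p * ev q" for p q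
    by (induction p) (simp_all add: ev_0 ev_pCons ev_add ev_smult algebra_simps)
  obtain r where r: "r \<noteq> 0" "ev r = 0"
  proof -
    from assms obtain p' where p': "\<forall>i. coeff p' i \<in> \<rat>" "p' \<noteq> 0" "poly p' x = 0"
      unfolding algebraic_altdef by blast
    then obtain q where "p' = map_poly of_rat q"
      using ratpolyE by blast
    with p' show ?thesis
      by (intro that[of q]) (auto simp: ev_def)
  qed
  define m0 where "m0 = arg_min degree (\<lambda>p. p \<noteq> 0 \<and> ev p = 0)"
  have m0: "m0 \<noteq> 0" "ev m0 = 0" and m0_min: "\<And>p. p \<noteq> 0 \<Longrightarrow> ev p = 0 \<Longrightarrow> degree m0 \<le> degree p"
    using arg_min_nat_lemma[of "\<lambda>p. p \<noteq> 0 \<and> ev p = 0" r degree] r unfolding m0_def by auto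
  define m where "m = smult (inverse (lead_coeff m0)) m0"
  have m: "m \<noteq> 0" "lead_coeff m = 1" "ev m = 0" "degree m = degree m0"
    using m0 by (auto simp: m_def ev_smult)
  have not_unit: "\<not> p dvd 1" if "ev p = 0" for p
  proof
    assume "p dvd 1"
    then obtain q where "1 = p * q" by (elim dvdE)
    hence "ev 1 = ev p * ev q" by (metis ev_mult)
    with that ev_const[of 1] show False by (simp add: one_pCons)
  qed
  have dvd: "m dvd p" if "ev p = 0" for p
  proof (rule ccontr)
    assume "\<not> m dvd p"
    hence nz: "p mod m \<noteq> 0" by (simp add: dvd_eq_mod_eq_0)
    have "ev p = ev (p div m * m + p mod m)" by simp
    hence "ev (p mod m) = 0" unfolding ev_add ev_mult using that m by simp
    with nz m0_min[of "p mod m"] degree_mod_less[of m p] m show False by auto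
  qed
  have "irreducible m"
  proof (rule irreducibleI)
    show "m \<noteq> 0" "\<not> m dvd 1" using m not_unit by auto
  next
    fix a b assume ab: "m = a * b"
    with m have nz: "a \<noteq> 0" "b \<noteq> 0" by auto
    hence deg: "degree m = degree a + degree b" using ab by (simp add: degree_mult_eq)
    from ab m have "ev a = 0 \<or> ev b = 0" by (simp add: ev_mult)
    with m0_min[of a] m0_min[of b] deg nz m have "degree b = 0 \<or> degree a = 0" by auto
    with nz show "a dvd 1 \<or> b dvd 1" by (auto simp: is_unit_iff_degree)
  qed
  show ?thesis
  proof (rule ex1I[of _ m])
    show "is_min_poly_rat m x"
      using m \<open>irreducible m\<close> by (simp add: is_min_poly_rat_def ev_def)
  next
    fix p assume "is_min_poly_rat p x"
    hence p: "lead_coeff p = 1" "irreducible p" "ev p = 0"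
      by (auto simp: is_min_poly_rat_def ev_def)
    from dvd[OF p(3)] obtain k where k: "p = m * k" by (elim dvdE)
    with p(2) not_unit[OF m(3)] have "k dvd 1" by (auto dest: irreducibleD)
    moreover have "k \<noteq> 0" using k p by auto
    ultimately have "degree k = 0" by (simp add: is_unit_iff_degree)
    then obtain c where c: "k = [:c:]" by (elim degree_eq_zeroE)
    with k p(1) m(2) have "c = 1" by (auto simp: lead_coeff_mult split: if_splits)
    with c k show "p = m" by simp
  qed
qed

end

theory Submission
  imports
    Defs
    "Jordan_Normal_Form.Char_Poly"
    "HOL-Computational_Algebra.Field_as_Ring"
begin

text \<open>
  A maximal orthogonal set \<open>E\<close> of nonzero vectors of a positive definite lattice \<open>L\<close> is finite, and
  \<open>Q v = (\<Sum>e\<in>E. B(v,e)\<^sup>2 / Q e)\<close> for \<open>v\<close> in \<open>L\<close>.  All summands are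
  nonnegative under every embedding of \<open>K\<close> into the reals, hence the
  algebraic integers \<open>2 * B(v,e)\<close> have house at most \<open>2 * sqrt (house (Q v) * C)\<close>, where \<open>C\<close> bounds
  the houses of all \<open>Q e\<close>.

  By the Northcott property there is a proper subfield \<open>R\<close> of \<open>K\<close>, of finite degree, containing all
  \<open>Q e\<close> and all totally positive integers of house less than \<open>36 * C\<close>, and among the totally
  positive integers outside \<open>R\<close> there is one, \<open>\<alpha>\<close>, of minimal house.  If \<open>\<alpha> = Q v\<close>, then
  some \<open>2 * B(v,e)\<close> lies outside \<open>R\<close>; shifted by a suitable natural number it is a totally positive
  integer outside \<open>R\<close>, of house at most \<open>4 * sqrt (house \<alpha> * C) + 1 < house \<alpha>\<close>, contradicting
  minimality.
\<close>

section \<open>Conjugates and house\<close>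

lemma map_poly_of_rat_mult:
  "map_poly of_rat (p * q) = map_poly of_rat p * (map_poly of_rat q :: 'a::field_char_0 poly)"
proof -
  interpret map_poly_comm_semiring_hom "of_rat :: rat \<Rightarrow> 'a" ..
  show ?thesis by (rule hom_mult)
qed

lemma is_min_poly_rat_min_poly_rat:
  assumes "algebraic x"
  shows "is_min_poly_rat (min_poly_rat x) x"
  unfolding min_poly_rat_def by (rule theI'[OF algebraic_ex1_min_poly_rat[OF assms]])

text \<open>If the irreducible minimal polynomial did not divide \<open>p\<close>, the two would be
  coprime, and a Bezout identity evaluated at \<open>x\<close> would read 0 = 1.\<close>

lemma min_poly_rat_dvd:
  fixes x :: "'k::field_char_0"
  assumes x: "algebraic x" and p: "poly (map_poly of_rat p) x = 0"
  shows "min_poly_rat x dvd p"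
proof (rule ccontr)
  let ?m = "min_poly_rat x"
  have m: "irreducible ?m" "poly (map_poly of_rat ?m) x = 0"
    using is_min_poly_rat_min_poly_rat[OF x] by (auto simp: is_min_poly_rat_def)
  assume "\<not> ?m dvd p"
  hence "coprime ?m p"
    using m(1) by (metis irreducible_imp_prime_elem_gcd prime_elem_imp_coprime)
  then obtain u v where "u * ?m + v * p = 1"
    using bezout_coefficients_fst_snd[of ?m p] by auto
  hence "poly (map_poly of_rat (u * ?m + v * p)) x = 1"
    by simp
  thus False
    using m(2) p by (simp add: of_rat_hom.map_poly_hom_add map_poly_of_rat_mult)
qed

lemma min_poly_rat_nonzero: "algebraic x \<Longrightarrow> min_poly_rat x \<noteq> 0"
  using is_min_poly_rat_min_poly_rat[of x] by (auto simp: is_min_poly_rat_def)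

text \<open>This form says that p(x) \<mapsto> p(z) is well defined on \<rat>[x], which is what the
  construction of embeddings needs.\<close>

lemma conjugates_eq_roots:
  assumes "algebraic x"
  shows "z \<in> conjugates x \<longleftrightarrow>
    (\<forall>p. poly (map_poly of_rat p) x = 0 \<longrightarrow> poly (map_poly of_rat p) z = 0)"
proof
  assume z: "z \<in> conjugates x"
  show "\<forall>p. poly (map_poly of_rat p) x = 0 \<longrightarrow> poly (map_poly of_rat p) z = 0"
  proof (intro allI impI)
    fix p assume "poly (map_poly of_rat p) x = 0"
    from min_poly_rat_dvd[OF assms this] obtain k where "p = min_poly_rat x * k"
      by (elim dvdE)
    with z show "poly (map_poly of_rat p) z = 0"
      by (simp add: conjugates_def map_poly_of_rat_mult)
  qed
next
  assume "\<forall>p. poly (map_poly of_rat p) x = 0 \<longrightarrow> poly (map_poly of_rat p) z = 0"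
  thus "z \<in> conjugates x"
    using is_min_poly_rat_min_poly_rat[OF assms] by (auto simp: is_min_poly_rat_def conjugates_def)
qed

text \<open>A root 0 would make X a factor of the irreducible minimal polynomial, leaving a constant
  multiple of X and hence \<open>x = 0\<close>.\<close>

lemma zero_notin_conjugates:
  assumes "algebraic x" "x \<noteq> 0"
  shows "0 \<notin> conjugates x"
proof
  let ?m = "min_poly_rat x"
  assume "0 \<in> conjugates x"
  hence "poly ?m 0 = 0"
    by (simp add: conjugates_def poly_0_coeff_0 coeff_map_poly)
  then obtain k where k: "?m = [:0, 1:] * k"
    by (metis dvdE minus_zero poly_eq_0_iff_dvd)
  have m: "irreducible ?m" "poly (map_poly of_rat ?m) x = 0"
    using is_min_poly_rat_min_poly_rat[OF assms(1)] by (auto simp: is_min_poly_rat_def)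
  have "\<not> [:0, 1:] dvd (1 :: rat poly)"
    by (simp add: is_unit_iff_degree)
  hence "k dvd 1"
    using irreducibleD[OF m(1) k] by blast
  then obtain c where c: "k = [:c:]" "c \<noteq> 0"
    by (cases k rule: pCons_cases) (auto simp: is_unit_iff_degree split: if_splits)
  have "poly (map_poly of_rat [:0, c:]) x = 0"
    using m(2) k c by simp
  thus False using assms(2) c by (simp add: map_poly_pCons)
qed

lemma finite_conjugates: "algebraic x \<Longrightarrow> finite (conjugates x)"
  unfolding conjugates_def by (rule poly_roots_finite) (simp add: min_poly_rat_nonzero)

lemma conjugates_nonempty:
  fixes x :: "'k::field_char_0"
  assumes "algebraic x"
  shows "conjugates x \<noteq> {}"
proof -
  let ?m = "min_poly_rat x"
  have "degree ?m \<noteq> 0"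
  proof
    assume "degree ?m = 0"
    then obtain c where "?m = [:c:]" by (elim degree_eq_zeroE)
    with is_min_poly_rat_min_poly_rat[OF assms] show False
      by (auto simp: is_min_poly_rat_def)
  qed
  hence "\<not> constant (poly (map_poly of_rat ?m :: complex poly))"
    by (simp add: constant_degree degree_map_poly)
  thus ?thesis
    using fundamental_theorem_of_algebra by (auto simp: conjugates_def)
qed

lemma norm_le_house:
  "algebraic x \<Longrightarrow> z \<in> conjugates x \<Longrightarrow> norm z \<le> house x"
  unfolding house_def by (rule Max_ge) (auto simp: finite_conjugates)

lemma house_le_iff:
  "algebraic x \<Longrightarrow> house x \<le> r \<longleftrightarrow> (\<forall>z\<in>conjugates x. norm z \<le> r)"
  unfolding house_def by (subst Max_le_iff) (auto simp: finite_conjugates conjugates_nonempty)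

section \<open>Embeddings into the complex numbers\<close>

text \<open>
  A partial embedding is the graph of a ring homomorphism into the complex numbers defined on a
  subalgebra of \<open>'k\<close> over the rationals.  By additivity, the condition on \<open>(0, w)\<close> is single-valuedness.
\<close>

definition partial_embedding :: "('k::field_char_0 \<times> complex) set \<Rightarrow> bool" where
  "partial_embedding G \<longleftrightarrow> (\<forall>q. (of_rat q, of_rat q) \<in> G) \<and>
     (\<forall>a w b v. (a, w) \<in> G \<longrightarrow> (b, v) \<in> G \<longrightarrow> (a + b, w + v) \<in> G \<and> (a * b, w * v) \<in> G) \<and>
     (\<forall>w. (0, w) \<in> G \<longrightarrow> w = 0)"

context
  fixes G :: "('k::field_char_0 \<times> complex) set"
  assumes G: "partial_embedding G"
begin

lemma partial_embedding_rat: "(of_rat q, of_rat q) \<in> G"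
  using G by (simp add: partial_embedding_def)

lemma partial_embedding_0: "(0, 0) \<in> G"
  using partial_embedding_rat[of 0] by simp

lemma partial_embedding_add: "(a, w) \<in> G \<Longrightarrow> (b, v) \<in> G \<Longrightarrow> (a + b, w + v) \<in> G"
  using G by (simp add: partial_embedding_def)

lemma partial_embedding_mult: "(a, w) \<in> G \<Longrightarrow> (b, v) \<in> G \<Longrightarrow> (a * b, w * v) \<in> G"
  using G by (simp add: partial_embedding_def)

lemma partial_embedding_diff:
  assumes "(a, w) \<in> G" "(b, v) \<in> G" shows "(a - b, w - v) \<in> G"
  using partial_embedding_add[OF assms(1) partial_embedding_mult[OF partial_embedding_rat[of "-1"] assms(2)]]
  by (simp add: of_rat_minus)

lemma partial_embedding_sum:
  "(\<And>i. i \<in> I \<Longrightarrow> (f i, g i) \<in> G) \<Longrightarrow> (sum f I, sum g I) \<in> G"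
  by (induction I rule: infinite_finite_induct)
    (auto simp: partial_embedding_0 intro: partial_embedding_add)

lemma partial_embedding_eq_0: "(0, w) \<in> G \<Longrightarrow> w = 0"
  using G by (simp add: partial_embedding_def)

lemma partial_embedding_unique: "(a, w) \<in> G \<Longrightarrow> (a, v) \<in> G \<Longrightarrow> w = v"
  using partial_embedding_diff[of a w a v] partial_embedding_eq_0[of "w - v"] by simp

lemma partial_embedding_poly_rat:
  "(a, w) \<in> G \<Longrightarrow> (poly (map_poly of_rat p) a, poly (map_poly of_rat p) w) \<in> G"
  by (induction p)
    (auto simp: of_rat_hom.map_poly_pCons_hom partial_embedding_0
      intro!: partial_embedding_add partial_embedding_mult partial_embedding_rat)

text \<open>A rational relation p(a) = 0 puts the pair (0, p(w)) into \<open>G\<close>, so p(w) = 0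
  by single-valuedness.\<close>

lemma partial_embedding_conjugate:
  assumes "(a, w) \<in> G" "algebraic a"
  shows "w \<in> conjugates a"
  unfolding conjugates_eq_roots[OF assms(2)]
  using partial_embedding_poly_rat[OF assms(1)] partial_embedding_eq_0 by metis

text \<open>The embedding applied to coefficients, kept as a relation because \<open>G\<close> is
  defined on only part of \<open>'k\<close>.\<close>

definition coeffwise_in :: "'k poly \<Rightarrow> complex poly \<Rightarrow> bool" where
  "coeffwise_in p p' \<longleftrightarrow> (\<forall>i. (coeff p i, coeff p' i) \<in> G)"

lemma coeffwise_in_0: "coeffwise_in 0 p' \<Longrightarrow> p' = 0"
  using partial_embedding_eq_0 by (auto simp: coeffwise_in_def poly_eq_iff)

lemma coeffwise_in_diff:
  "coeffwise_in p p' \<Longrightarrow> coeffwise_in q q' \<Longrightarrow> coeffwise_in (p - q) (p' - q')"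
  by (simp add: coeffwise_in_def partial_embedding_diff)

lemma coeffwise_in_add:
  "coeffwise_in p p' \<Longrightarrow> coeffwise_in q q' \<Longrightarrow> coeffwise_in (p + q) (p' + q')"
  by (simp add: coeffwise_in_def partial_embedding_add)

lemma coeffwise_in_mult:
  "coeffwise_in p p' \<Longrightarrow> coeffwise_in q q' \<Longrightarrow> coeffwise_in (p * q) (p' * q')"
  by (auto simp: coeffwise_in_def coeff_mult intro!: partial_embedding_sum partial_embedding_mult)

lemma coeffwise_in_monom: "(a, w) \<in> G \<Longrightarrow> coeffwise_in (monom a n) (monom w n)"
  by (simp add: coeffwise_in_def partial_embedding_0)

lemma coeffwise_in_rat: "coeffwise_in (map_poly of_rat p) (map_poly of_rat p)"
  by (simp add: coeffwise_in_def partial_embedding_rat)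

end

text \<open>Let \<open>m\<close> be a nonzero polynomial of least degree over the domain of
  \<open>G\<close> that vanishes at \<open>y\<close>, and send \<open>y\<close> to a root
  \<open>z\<close> of its image \<open>m'\<close>. The assignment p(y) \<mapsto> p'(z) is well
  defined because \<open>m\<close> pseudo-divides every \<open>p\<close> that vanishes at
  \<open>y\<close>.\<close>

lemma partial_embedding_extend:
  fixes G :: "('k::field_char_0 \<times> complex) set" and y :: 'k
  assumes G: "partial_embedding G" and alg: "\<And>x::'k. algebraic x"
  shows "\<exists>H z. partial_embedding H \<and> G \<subseteq> H \<and> (y, z) \<in> H"
proof -
  note [intro] = coeffwise_in_diff[OF G] coeffwise_in_add[OF G] coeffwise_in_mult[OF G]
    coeffwise_in_monom[OF G]
  define P where "P = (\<lambda>m. (\<exists>m'. coeffwise_in G m m') \<and> m \<noteq> 0 \<and> poly m y = 0)"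
  have "P (map_poly of_rat (min_poly_rat y))"
    using is_min_poly_rat_min_poly_rat[OF alg[of y]] min_poly_rat_nonzero[OF alg[of y]]
      coeffwise_in_rat[OF G] unfolding P_def is_min_poly_rat_def by auto
  then obtain m where "P m" and min: "\<And>p. P p \<Longrightarrow> degree m \<le> degree p"
    using arg_min_nat_lemma[of P _ degree] by blast
  then obtain m' where m: "coeffwise_in G m m'" "m \<noteq> 0" "poly m y = 0"
    by (auto simp: P_def)
  let ?c = "lead_coeff m" and ?c' = "coeff m' (degree m)"
  have cc: "(?c, ?c') \<in> G"
    using m(1) by (simp add: coeffwise_in_def[OF G])
  \<comment> \<open>The image of the leading coefficient is a conjugate of a nonzero number. This
    also makes \<open>m'\<close> nonconstant, so that it has a complex root.\<close>
  have c': "?c' \<noteq> 0"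
    using zero_notin_conjugates[OF alg, of ?c] partial_embedding_conjugate[OF G cc alg] m(2) by auto
  have "degree m \<noteq> 0"
    using m by (auto elim!: degree_eq_zeroE)
  with c' have "degree m' \<noteq> 0"
    using le_degree[of m' "degree m"] by auto
  then obtain z where z: "poly m' z = 0"
    using fundamental_theorem_of_algebra[of m'] by (auto simp: constant_degree)
  \<comment> \<open>Division by \<open>m\<close> with the leading coefficient of \<open>m\<close> kept as a factor, so that no inverses in
    the domain of \<open>G\<close> are needed.\<close>
  have root: "poly p' z = 0" if "coeffwise_in G p p'" "poly p y = 0" for p p'
    using that
  proof (induction "degree p" arbitrary: p p' rule: less_induct)
    case less
    show ?case
    proof (cases "p = 0")
      case True
      with less.prems(1) have "p' = 0"
        by (intro coeffwise_in_0[OF G]) simp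
      thus ?thesis by simp
    next
      case False
      hence le: "degree m \<le> degree p"
        using less.prems min[of p] by (auto simp: P_def)
      define k where "k = degree p - degree m"
      define r where "r = monom ?c 0 * p - monom (lead_coeff p) k * m"
      define r' where "r' = monom ?c' 0 * p' - monom (coeff p' (degree p)) k * m'"
      have "(lead_coeff p, coeff p' (degree p)) \<in> G"
        using less.prems(1) by (simp add: coeffwise_in_def[OF G])
      hence rr: "coeffwise_in G r r'"
        unfolding r_def r'_def using less.prems(1) m(1) cc by auto
      have ry: "poly r y = 0"
        using less.prems(2) m(3) by (simp add: r_def)
      have "poly r' z = 0"
      proof (cases "r = 0")
        case True
        with rr have "r' = 0"
          by (intro coeffwise_in_0[OF G]) simp
        thus ?thesis by simp
      next
        case False
        have "degree r \<le> degree p"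
          unfolding r_def using le
          by (intro degree_diff_le order.trans[OF degree_mult_le])
            (auto simp: k_def degree_monom_eq m(2) intro!: order.trans[OF add_mono[OF degree_monom_le order.refl]])
        moreover have "coeff r (degree p) = 0"
          using le by (simp add: r_def k_def coeff_monom_mult)
        ultimately have "degree r < degree p"
          using False by (metis leading_coeff_0_iff order_le_less)
        thus ?thesis using less.hyps rr ry by blast
      qed
      \<comment> \<open>At \<open>z\<close> the term with \<open>m'\<close> vanishes, so
        \<open>r'\<close> evaluates to \<open>?c'\<close> times the value of
        \<open>p'\<close>.\<close>
      thus "poly p' z = 0"
        using z c' by (simp add: r'_def poly_monom)
    qed
  qed
  \<comment> \<open>The graph on the algebra generated by \<open>y\<close> over the domain of
    \<open>G\<close>; the fact \<open>root\<close> makes it single-valued.\<close>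
  define H where "H = {(poly p y, poly p' z) | p p'. coeffwise_in G p p'}"
  have HI: "(poly p y, poly p' z) \<in> H" if "coeffwise_in G p p'" for p p'
    using that by (auto simp: H_def)
  have GH: "G \<subseteq> H"
  proof
    fix g assume "g \<in> G"
    then obtain a w where g: "g = (a, w)" "(a, w) \<in> G" by (cases g) auto
    show "g \<in> H"
      using HI[OF coeffwise_in_monom[OF G g(2), of 0]] g(1) by (simp add: poly_monom)
  qed
  have "(y, z) \<in> H"
    using HI[OF coeffwise_in_monom[OF G, of 1 1 1]] partial_embedding_rat[OF G, of 1]
    by (simp add: poly_monom)
  moreover have "partial_embedding H"
    unfolding partial_embedding_def
  proof (intro conjI allI impI)
    show "(of_rat q, of_rat q) \<in> H" for q
      using partial_embedding_rat[OF G, of q] GH by auto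
    show "w = 0" if "(0, w) \<in> H" for w
      using that root by (auto simp: H_def)
    fix a w b v assume "(a, w) \<in> H" "(b, v) \<in> H"
    then obtain p p' q q' where pq: "coeffwise_in G p p'" "coeffwise_in G q q'"
      "a = poly p y" "w = poly p' z" "b = poly q y" "v = poly q' z"
      by (auto simp: H_def)
    show "(a + b, w + v) \<in> H" "(a * b, w * v) \<in> H"
      using HI[OF coeffwise_in_add[OF G pq(1,2)]] HI[OF coeffwise_in_mult[OF G pq(1,2)]] pq(3-)
      by simp_all
  qed
  ultimately show ?thesis using GH by blast
qed

lemma partial_embedding_generated:
  assumes "algebraic x" "z \<in> conjugates x"
  shows "partial_embedding {(poly (map_poly of_rat p) x, poly (map_poly of_rat p) z) | p. True}"
    (is "partial_embedding ?G")
proof -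
  have GI: "(poly (map_poly of_rat p) x, poly (map_poly of_rat p) z) \<in> ?G" for p
    by auto
  show ?thesis
    unfolding partial_embedding_def
  proof (intro conjI allI impI)
    show "(of_rat q, of_rat q) \<in> ?G" for q
      using GI[of "[:q:]"] by (simp add: of_rat_hom.map_poly_pCons_hom)
    show "w = 0" if "(0, w) \<in> ?G" for w
      using that assms(2) unfolding conjugates_eq_roots[OF assms(1)] by auto
    fix a w b v assume "(a, w) \<in> ?G" "(b, v) \<in> ?G"
    then obtain p q where
      "a = poly (map_poly of_rat p) x" "w = poly (map_poly of_rat p) z"
      "b = poly (map_poly of_rat q) x" "v = poly (map_poly of_rat q) z"
      by auto
    thus "(a + b, w + v) \<in> ?G" "(a * b, w * v) \<in> ?G"
      using GI[of "p + q"] GI[of "p * q"]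
      by (simp_all add: of_rat_hom.map_poly_hom_add map_poly_of_rat_mult)
  qed
qed

text \<open>Members of a chain are comparable, so any two pairs of the union already lie in a common
  member.\<close>

lemma partial_embedding_Union:
  assumes "C \<noteq> {}" "subset.chain (Collect partial_embedding) C"
  shows "partial_embedding (\<Union>C)"
  unfolding partial_embedding_def
proof (intro conjI allI impI)
  have C: "partial_embedding X" if "X \<in> C" for X
    using assms(2) that by (auto simp: subset_chain_def)
  show "(of_rat q, of_rat q) \<in> \<Union>C" for q
    using assms(1) C partial_embedding_rat by blast
  show "w = 0" if "(0, w) \<in> \<Union>C" for w
    using that C partial_embedding_eq_0 by blast
  fix a w b v assume "(a, w) \<in> \<Union>C" "(b, v) \<in> \<Union>C"
  then obtain X where X: "X \<in> C" "(a, w) \<in> X" "(b, v) \<in> X"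
    using assms(2) unfolding subset_chain_def by blast
  thus "(a + b, w + v) \<in> \<Union>C" "(a * b, w * v) \<in> \<Union>C"
    using partial_embedding_add[OF C[OF X(1)]] partial_embedding_mult[OF C[OF X(1)]] by blast+
qed

text \<open>Zorn's lemma extends p(x) \<mapsto> p(z) to a maximal partial embedding, whose domain is
  all of \<open>'k\<close> since any further element could be adjoined. Bounds on a house can
  therefore be checked under each embedding.\<close>

lemma conjugate_embedding:
  fixes x :: "'k::field_char_0"
  assumes alg: "\<And>x::'k. algebraic x" and z: "z \<in> conjugates x"
  shows "\<exists>\<phi>::'k \<Rightarrow> complex. field_hom \<phi> \<and> \<phi> x = z"
proof -
  define G where "G = {(poly (map_poly of_rat p) x, poly (map_poly of_rat p) z) | p. True}"
  let ?A = "{H. partial_embedding H \<and> G \<subseteq> H}"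
  have "\<exists>M\<in>?A. \<forall>X\<in>?A. M \<subseteq> X \<longrightarrow> X = M"
  proof (rule subset_Zorn_nonempty)
    show "?A \<noteq> {}"
      using partial_embedding_generated[OF alg z] by (auto simp: G_def)
    fix C assume C: "C \<noteq> {}" "subset.chain ?A C"
    hence "subset.chain (Collect partial_embedding) C"
      by (auto simp: subset_chain_def)
    hence "partial_embedding (\<Union>C)"
      by (rule partial_embedding_Union[OF C(1)])
    moreover from C obtain X where "X \<in> C" "G \<subseteq> X"
      by (auto simp: subset_chain_def)
    ultimately show "\<Union>C \<in> ?A"
      by blast
  qed
  then obtain M where M: "partial_embedding M" "G \<subseteq> M"
    and max: "\<And>X. partial_embedding X \<Longrightarrow> G \<subseteq> X \<Longrightarrow> M \<subseteq> X \<Longrightarrow> X = M"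
    by (auto simp only: mem_Collect_eq Ball_def Bex_def)
  have "\<exists>w. (y, w) \<in> M" for y
  proof -
    obtain H w where H: "partial_embedding H" "M \<subseteq> H" "(y, w) \<in> H"
      using partial_embedding_extend[OF M(1) alg] by metis
    have "H = M"
      by (rule max[OF H(1) order.trans[OF M(2) H(2)] H(2)])
    with H(3) show ?thesis by auto
  qed
  then obtain \<phi> where \<phi>: "(y, \<phi> y) \<in> M" for y
    by metis
  have \<phi>_eq: "\<phi> y = w" if "(y, w) \<in> M" for y w
    using partial_embedding_unique[OF M(1) \<phi> that] .
  have "field_hom \<phi>"
  proof unfold_locales
    show "\<phi> 0 = 0" "\<phi> 1 = 1"
      using partial_embedding_rat[OF M(1), of 0] partial_embedding_rat[OF M(1), of 1]
      by (auto intro: \<phi>_eq)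
    show "\<phi> (a + b) = \<phi> a + \<phi> b" "\<phi> (a * b) = \<phi> a * \<phi> b" for a b
      by (intro \<phi>_eq partial_embedding_add partial_embedding_mult M(1) \<phi>)+
  qed
  moreover have "(x, z) \<in> G"
    unfolding G_def
    by (rule CollectI, rule exI[of _ "[:0, 1:]"]) (simp add: of_rat_hom.map_poly_pCons_hom)
  hence "\<phi> x = z"
    using M(2) by (blast intro: \<phi>_eq)
  ultimately show ?thesis by blast
qed

text \<open>A field homomorphism fixes the rationals, so its graph is a partial embedding.\<close>

lemma embedding_in_conjugates:
  fixes x :: "'k::field_char_0"
  assumes "field_hom (\<phi> :: 'k \<Rightarrow> complex)" "algebraic x"
  shows "\<phi> x \<in> conjugates x"
proof -
  interpret field_hom \<phi> by fact
  have nat: "\<phi> (of_nat n) = of_nat n" for n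
    by (induction n) (simp_all add: hom_add)
  have int: "\<phi> (of_int n) = of_int n" for n
    by (cases n) (simp_all add: nat hom_uminus hom_minus)
  have rat: "\<phi> (of_rat q) = of_rat q" for q
    by (cases q) (simp add: of_rat_rat hom_div int)
  have "partial_embedding {(y, \<phi> y) | y. True}"
    unfolding partial_embedding_def using rat by (auto simp: hom_add hom_mult)
  thus ?thesis
    by (rule partial_embedding_conjugate[OF _ _ assms(2)]) auto
qed

section \<open>Algebraic integers form a ring\<close>

text \<open>The vector \<open>b\<close> is an eigenvector of an integer matrix for the eigenvalue
  \<open>x\<close>, so \<open>x\<close> is a root of a monic integer characteristic
  polynomial.\<close>

lemma algebraic_int_if_eigenvector:
  fixes x :: "'k::field_char_0" and M :: "nat \<Rightarrow> nat \<Rightarrow> int"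
  assumes eig: "\<And>i. i < n \<Longrightarrow> x * b i = (\<Sum>j<n. of_int (M i j) * b j)"
    and nz: "i0 < n" "b i0 \<noteq> 0"
  shows "algebraic_int x"
proof -
  define A where "A = mat n n (\<lambda>(i, j). M i j)"
  let ?A = "map_mat of_int A :: 'k mat"
  have A: "A \<in> carrier_mat n n" by (simp add: A_def)
  hence A': "?A \<in> carrier_mat n n" by simp
  have "eigenvector ?A (vec n b) x"
    unfolding eigenvector_def
  proof (intro conjI)
    show "vec n b \<noteq> 0\<^sub>v (dim_row ?A)"
      using nz A by (auto simp: vec_eq_iff)
    show "?A *\<^sub>v vec n b = x \<cdot>\<^sub>v vec n b"
      using eig by (intro eq_vecI) (auto simp: A_def scalar_prod_def atLeast0LessThan)
  qed (use A in auto)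
  hence "poly (char_poly ?A) x = 0"
    using eigenvalue_root_char_poly[OF A'] by (auto simp: eigenvalue_def)
  moreover have "char_poly ?A = map_poly of_int (char_poly A)"
    by (rule of_int_hom.char_poly_hom[OF A])
  moreover have "lead_coeff (char_poly A) = 1"
    using degree_monic_char_poly[OF A] by simp
  ultimately show ?thesis
    unfolding algebraic_int_altdef_ipoly by metis
qed

lemma algebraic_int_if_eigenvector_finite:
  fixes x :: "'k::field_char_0" and M :: "'i \<Rightarrow> 'i \<Rightarrow> int"
  assumes fin: "finite I"
    and eig: "\<And>i. i \<in> I \<Longrightarrow> x * b i = (\<Sum>j\<in>I. of_int (M i j) * b j)"
    and nz: "i0 \<in> I" "b i0 \<noteq> 0"
  shows "algebraic_int x"
proof -
  obtain h where h: "bij_betw h {..<card I} I"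
    using ex_bij_betw_nat_finite[OF fin] by (auto simp: atLeast0LessThan)
  obtain k0 where "k0 < card I" "h k0 = i0"
    using h nz(1) by (metis bij_betw_imp_surj_on imageE lessThan_iff)
  moreover have "x * b (h k) = (\<Sum>j<card I. of_int (M (h k) (h j)) * b (h j))"
    if "k < card I" for k
  proof -
    have "h k \<in> I" using h that by (auto simp: bij_betw_def)
    with sum.reindex_bij_betw[OF h, of "\<lambda>j. of_int (M (h k) j) * b j"] eig[of "h k"]
    show ?thesis by simp
  qed
  ultimately show ?thesis
    using algebraic_int_if_eigenvector[of "card I" x "\<lambda>k. b (h k)" "\<lambda>k j. M (h k) (h j)" k0] nz(2)
    by auto
qed

text \<open>\<open>M\<close> is the companion matrix of a monic integer polynomial with root
  \<open>x\<close>: it describes multiplication by \<open>x\<close> on 1, x, ..., x^(n-1).\<close>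

lemma algebraic_int_companion:
  fixes x :: "'k::field_char_0"
  assumes "algebraic_int x"
  shows "\<exists>n>0. \<exists>M :: nat \<Rightarrow> nat \<Rightarrow> int.
    \<forall>i<n. x * x ^ i = (\<Sum>k<n. of_int (M i k) * x ^ k)"
proof -
  obtain p :: "int poly" where p: "poly (map_poly of_int p) x = 0" "lead_coeff p = 1"
    using assms unfolding algebraic_int_altdef_ipoly by blast
  define n where "n = degree p"
  have "n > 0"
  proof (rule ccontr)
    assume "\<not> n > 0"
    then obtain c where "p = [:c:]" by (auto simp: n_def elim!: degree_eq_zeroE)
    with p show False by simp
  qed
  have "0 = (\<Sum>k\<le>n. of_int (coeff p k) * x ^ k)"
    using p(1) by (simp add: poly_altdef n_def)
  also have "\<dots> = (\<Sum>k<n. of_int (coeff p k) * x ^ k) + x ^ n"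
    using p(2) by (simp add: n_def flip: lessThan_Suc_atMost)
  finally have xn: "x ^ n = (\<Sum>k<n. of_int (- coeff p k) * x ^ k)"
    by (simp add: sum_negf eq_neg_iff_add_eq_0 add.commute)
  define M where "M = (\<lambda>i k. if Suc i < n then (if k = Suc i then 1 else 0) else - coeff p k)"
  have "x * x ^ i = (\<Sum>k<n. of_int (M i k) * x ^ k)" if "i < n" for i
  proof (cases "Suc i < n")
    case True
    have "(\<Sum>k<n. of_int (M i k) * x ^ k) = (\<Sum>k<n. if k = Suc i then x ^ k else 0)"
      using True by (intro sum.cong) (auto simp: M_def)
    thus ?thesis using True by simp
  next
    case False
    with that have "n = Suc i" by simp
    thus ?thesis using xn by (simp add: M_def)
  qed
  with \<open>n > 0\<close> show ?thesis by blast
qed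

lemma
  fixes x y :: "'k::field_char_0"
  assumes "algebraic_int x" "algebraic_int y"
  shows algebraic_int_plus: "algebraic_int (x + y)"
    and algebraic_int_times: "algebraic_int (x * y)"
proof -
  obtain n and A :: "nat \<Rightarrow> nat \<Rightarrow> int" where n: "n > 0"
    "\<And>i. i < n \<Longrightarrow> x * x ^ i = (\<Sum>k<n. of_int (A i k) * x ^ k)"
    using algebraic_int_companion[OF assms(1)] by metis
  obtain m and B :: "nat \<Rightarrow> nat \<Rightarrow> int" where m: "m > 0"
    "\<And>i. i < m \<Longrightarrow> y * y ^ i = (\<Sum>k<m. of_int (B i k) * y ^ k)"
    using algebraic_int_companion[OF assms(2)] by metis
  define b where "b = (\<lambda>(i, j). x ^ i * y ^ j)"
  define I where "I = {..<n} \<times> {..<m}"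
  have I: "finite I" "(0, 0) \<in> I" "b (0, 0) \<noteq> 0"
    using n(1) m(1) by (auto simp: I_def b_def)
  \<comment> \<open>The Kronecker product A \<otimes> B, describing multiplication by
    \<open>x * y\<close> on the monomials \<open>x ^ i * y ^ j\<close>. Likewise \<open>S\<close>
    below is A \<otimes> 1 + 1 \<otimes> B, for \<open>x + y\<close>.\<close>
  define P where "P = (\<lambda>(i, j) (k, l). A i k * B j l)"
  define S where "S = (\<lambda>(i, j) (k, l). (if j = l then A i k else 0) + (if i = k then B j l else 0))"
  have "x * y * b p = (\<Sum>q\<in>I. of_int (P p q) * b q)" if "p \<in> I" for p
  proof -
    obtain i j where p: "p = (i, j)" "i < n" "j < m" using \<open>p \<in> I\<close> by (auto simp: I_def)
    have "x * y * b p = (x * x ^ i) * (y * y ^ j)"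
      by (simp add: p b_def)
    also have "\<dots> = (\<Sum>k<n. \<Sum>l<m. of_int (A i k) * x ^ k * (of_int (B j l) * y ^ l))"
      by (simp add: n(2)[OF p(2)] m(2)[OF p(3)] sum_product)
    also have "\<dots> = (\<Sum>q\<in>I. of_int (P p q) * b q)"
      by (auto simp: I_def sum.cartesian_product P_def b_def p mult_ac intro!: sum.cong)
    finally show ?thesis .
  qed
  thus "algebraic_int (x * y)"
    by (rule algebraic_int_if_eigenvector_finite[where b = b and M = P, OF I(1) _ I(2,3)])
  have "(x + y) * b p = (\<Sum>q\<in>I. of_int (S p q) * b q)" if "p \<in> I" for p
  proof -
    obtain i j where p: "p = (i, j)" "i < n" "j < m" using \<open>p \<in> I\<close> by (auto simp: I_def)
    have "(\<Sum>q\<in>I. of_int (S p q) * b q) = (\<Sum>k<n. \<Sum>l<m. of_int (S p (k, l)) * b (k, l))"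
      by (simp add: I_def sum.cartesian_product)
    also have "\<dots> = (\<Sum>k<n. \<Sum>l<m. if j = l then of_int (A i k) * x ^ k * y ^ l else 0) +
        (\<Sum>k<n. \<Sum>l<m. if i = k then of_int (B j l) * y ^ l * x ^ k else 0)"
      by (simp only: sum.distrib [symmetric], intro sum.cong refl)
        (auto simp: S_def p b_def algebra_simps)
    also have "(\<Sum>k<n. \<Sum>l<m. if j = l then of_int (A i k) * x ^ k * y ^ l else 0) =
        x * x ^ i * y ^ j"
      using p by (simp add: n(2) sum_distrib_right)
    also have "(\<Sum>k<n. \<Sum>l<m. if i = k then of_int (B j l) * y ^ l * x ^ k else 0) =
        y * y ^ j * x ^ i"
      using p by (subst sum.swap) (simp add: m(2) sum_distrib_right)
    finally show ?thesis by (simp add: p b_def algebra_simps)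
  qed
  thus "algebraic_int (x + y)"
    by (rule algebraic_int_if_eigenvector_finite[where b = b and M = S, OF I(1) _ I(2,3)])
qed

text \<open>With \<open>c\<close> the leading coefficient and \<open>n\<close> the degree of an
  integer polynomial killing \<open>x\<close>, multiplying the relation by c^(n-1) gives a monic
  integer relation for \<open>c * x\<close>.\<close>

lemma algebraic_imp_multiple_algebraic_int:
  fixes x :: "'k::field_char_0"
  assumes "algebraic x"
  shows "\<exists>c::int. c \<noteq> 0 \<and> algebraic_int (of_int c * x)"
proof -
  obtain p :: "int poly" where p: "poly (map_poly of_int p) x = 0" "p \<noteq> 0"
    using assms by (elim algebraicE') auto
  define n where "n = degree p"
  define c where "c = lead_coeff p"
  define z where "z = of_int c * x"
  have "c \<noteq> 0" using p by (simp add: c_def)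
  have "n > 0"
  proof (rule ccontr)
    assume "\<not> n > 0"
    then obtain c where "p = [:c:]" by (auto simp: n_def elim!: degree_eq_zeroE)
    with p show False by simp
  qed
  have "0 = (\<Sum>k\<le>n. of_int (coeff p k) * x ^ k)"
    using p(1) by (simp add: poly_altdef n_def)
  also have "\<dots> = (\<Sum>k<n. of_int (coeff p k) * x ^ k) + of_int c * x ^ n"
    by (simp add: n_def c_def flip: lessThan_Suc_atMost)
  finally have xn: "of_int c * x ^ n = - (\<Sum>k<n. of_int (coeff p k) * x ^ k)"
    by (simp add: eq_neg_iff_add_eq_0 add.commute)
  have "z ^ n = of_int c ^ (n - 1) * (of_int c * x ^ n)"
    using \<open>n > 0\<close> by (cases n) (simp_all add: z_def power_mult_distrib)
  also have "\<dots> = (\<Sum>k<n. of_int (- coeff p k * c ^ (n - 1 - k)) * z ^ k)"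
    unfolding xn sum_negf[symmetric] sum_distrib_left
  proof (rule sum.cong)
    fix k assume "k \<in> {..<n}"
    hence "(of_int c :: 'k) ^ (n - 1) = of_int c ^ (n - 1 - k) * of_int c ^ k"
      by (simp flip: power_add)
    thus "of_int c ^ (n - 1) * - (of_int (coeff p k) * x ^ k) =
        of_int (- coeff p k * c ^ (n - 1 - k)) * z ^ k"
      by (simp add: z_def power_mult_distrib)
  qed simp
  finally have zn: "z ^ n = (\<Sum>k<n. of_int (- coeff p k * c ^ (n - 1 - k)) * z ^ k)" .
  have "algebraic_int z"
  proof (rule algebraic_int_if_eigenvector)
    show "0 < n" "z ^ 0 \<noteq> 0" using \<open>n > 0\<close> by auto
    show "z * z ^ i = (\<Sum>k<n. of_int (if Suc i < n then (if k = Suc i then 1 else 0)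
        else - coeff p k * c ^ (n - 1 - k)) * z ^ k)" if "i < n" for i
    proof (cases "Suc i < n")
      case True
      have "(\<Sum>k<n. of_int (if k = Suc i then 1 else 0) * z ^ k) =
          (\<Sum>k<n. if k = Suc i then z ^ k else 0)"
        by (intro sum.cong) auto
      thus ?thesis using True by simp
    next
      case False
      with that have "n = Suc i" by simp
      thus ?thesis using zn by simp
    qed
  qed
  with \<open>c \<noteq> 0\<close> show ?thesis by (auto simp: z_def)
qed

section \<open>Subalgebras over the rationals\<close>

text \<open>Closure under inverses is not demanded: for algebraic elements it follows, see
  \<open>rat_subalgebra_inverse\<close>.\<close>

definition rat_subalgebra :: "'k::field_char_0 set \<Rightarrow> bool" where
  "rat_subalgebra R \<longleftrightarrow> (\<forall>q. of_rat q \<in> R) \<and> (\<forall>x\<in>R. \<forall>y\<in>R. x + y \<in> R \<and> x * y \<in> R)"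

lemma
  assumes "rat_subalgebra R"
  shows rat_subalgebra_rat: "of_rat q \<in> R"
    and rat_subalgebra_add: "x \<in> R \<Longrightarrow> y \<in> R \<Longrightarrow> x + y \<in> R"
    and rat_subalgebra_mult: "x \<in> R \<Longrightarrow> y \<in> R \<Longrightarrow> x * y \<in> R"
  using assms by (auto simp: rat_subalgebra_def)

lemma rat_subalgebra_int: "rat_subalgebra R \<Longrightarrow> of_int c \<in> R"
  using rat_subalgebra_rat[of R "of_int c"] by simp

lemma rat_subalgebra_sum:
  assumes "rat_subalgebra R"
  shows "(\<And>i. i \<in> I \<Longrightarrow> f i \<in> R) \<Longrightarrow> sum f I \<in> R"
  using rat_subalgebra_int[OF assms, of 0]
  by (induction I rule: infinite_finite_induct) (auto intro: rat_subalgebra_add[OF assms])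

text \<open>Writing the minimal polynomial as a + X q with a \<noteq> 0 gives 1/x = -q(x)/a, a
  polynomial expression in \<open>x\<close>.\<close>

lemma rat_subalgebra_inverse:
  fixes x :: "'k::field_char_0"
  assumes R: "rat_subalgebra R" and x: "x \<in> R" "algebraic x"
  shows "inverse x \<in> R"
proof (cases "x = 0")
  case True
  thus ?thesis using rat_subalgebra_int[OF R, of 0] by simp
next
  case False
  obtain a q where aq: "min_poly_rat x = pCons a q" by (cases "min_poly_rat x")
  have "poly (map_poly of_rat (min_poly_rat x)) x = 0"
    using is_min_poly_rat_min_poly_rat[OF x(2)] by (simp add: is_min_poly_rat_def)
  hence eq: "of_rat a + x * poly (map_poly of_rat q) x = 0"
    by (simp add: aq of_rat_hom.map_poly_pCons_hom)
  have "a \<noteq> 0"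
    using zero_notin_conjugates[OF x(2) False]
    by (auto simp: conjugates_def aq of_rat_hom.map_poly_pCons_hom)
  have "poly (map_poly of_rat q) x \<in> R"
  proof (induction q)
    case 0
    show ?case using rat_subalgebra_int[OF R, of 0] by simp
  next
    case (pCons b q)
    thus ?case
      by (auto simp: of_rat_hom.map_poly_pCons_hom
          intro!: rat_subalgebra_add[OF R] rat_subalgebra_mult[OF R] rat_subalgebra_rat[OF R] x)
  qed
  hence "of_rat (- inverse a) * poly (map_poly of_rat q) x \<in> R"
    by (intro rat_subalgebra_mult[OF R] rat_subalgebra_rat[OF R])
  moreover have "x * poly (map_poly of_rat q) x = of_rat (- a)"
    using eq by (simp add: of_rat_minus add_eq_0_iff)
  hence "x * (of_rat (- inverse a) * poly (map_poly of_rat q) x) = of_rat (- inverse a * - a)"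
    by (simp add: of_rat_mult of_rat_minus mult.left_commute[of x])
  hence "of_rat (- inverse a) * poly (map_poly of_rat q) x = inverse x"
    using \<open>a \<noteq> 0\<close> by (intro inverse_unique[symmetric]) simp
  ultimately show ?thesis by simp
qed

lemma vector_space_of_rat: "vector_space (\<lambda>(q::rat) (x::'k::field_char_0). of_rat q * x)"
  by unfold_locales (simp_all add: of_rat_add of_rat_mult algebra_simps)

text \<open>Elements are adjoined one at a time: if \<open>B\<close> spans an algebra and
  \<open>y\<close> has degree n, the products b y^i with b in \<open>B\<close> and i < n span an
  algebra containing \<open>y\<close>.\<close>

lemma finite_dim_rat_subalgebra:
  fixes S :: "'k::field_char_0 set"
  assumes "finite S" "\<And>x. x \<in> S \<Longrightarrow> algebraic x"
  shows "\<exists>B. finite B \<and> S \<subseteq> module.span (\<lambda>(q::rat) (x::'k). of_rat q * x) B \<and>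
    rat_subalgebra (module.span (\<lambda>(q::rat) (x::'k). of_rat q * x) B)"
proof -
  interpret vector_space "\<lambda>(q::rat) (x::'k). of_rat q * x"
    by (rule vector_space_of_rat)
  from assms show ?thesis
  proof (induction S rule: finite_induct)
    case empty
    have "span {1} = range (of_rat :: rat \<Rightarrow> 'k)"
      by (simp add: span_singleton)
    moreover have "rat_subalgebra (range (of_rat :: rat \<Rightarrow> 'k))"
      unfolding rat_subalgebra_def by (auto simp flip: of_rat_add of_rat_mult)
    ultimately show ?case by (intro exI[of _ "{1}"]) simp
  next
    case (insert y S)
    then obtain B where B: "finite B" "S \<subseteq> span B" "rat_subalgebra (span B)"
      by auto
    have "algebraic y" using insert.prems by simp
    define p where "p = min_poly_rat y"
    define n where "n = degree p"
    have p: "poly (map_poly of_rat p) y = 0" "coeff p n = 1"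
      using is_min_poly_rat_min_poly_rat[OF \<open>algebraic y\<close>]
      by (auto simp: is_min_poly_rat_def p_def n_def)
    have "0 = (\<Sum>k\<le>n. of_rat (coeff p k) * y ^ k)"
      using p(1) by (simp add: poly_altdef n_def)
    also have "\<dots> = (\<Sum>k<n. of_rat (coeff p k) * y ^ k) + y ^ n"
      using p(2) by (simp flip: lessThan_Suc_atMost)
    finally have yn: "y ^ n = (\<Sum>k<n. of_rat (- coeff p k) * y ^ k)"
      by (simp add: of_rat_minus sum_negf eq_neg_iff_add_eq_0 add.commute)
    \<comment> \<open>Powers from \<open>n\<close> on are lowered by the minimal polynomial relation
      \<open>yn\<close>.\<close>
    have pow: "y ^ k \<in> span ((^) y ` {..<n})" for k
    proof (induction k rule: less_induct)
      case (less k)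
      show ?case
      proof (cases "k < n")
        case True
        thus ?thesis by (auto intro: span_base)
      next
        case False
        hence "y ^ k = y ^ (k - n) * y ^ n" by (simp flip: power_add)
        also have "\<dots> = (\<Sum>i<n. of_rat (- coeff p i) * y ^ (k - n + i))"
          unfolding yn sum_distrib_left by (intro sum.cong) (auto simp: power_add)
        also have "\<dots> \<in> span ((^) y ` {..<n})"
          using False less.IH by (intro span_sum span_scale) auto
        finally show ?thesis .
      qed
    qed
    define B' where "B' = (\<lambda>(b, i). b * y ^ i) ` (B \<times> {..<n})"
    have scale_right: "r * (of_rat c * x) \<in> span B'" if "r * x \<in> span B'" for r c x
      using span_scale[OF that, of c] by (simp add: mult.left_commute)
    have "r * u \<in> span B'" if r: "r \<in> span B" and u: "u \<in> span ((^) y ` {..<n})" for r u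
      using u
    proof (induction rule: span_induct)
      case base
      show ?case
        unfolding subspace_def
        by (auto simp: distrib_left intro: span_zero span_add scale_right)
    next
      case (step u)
      then obtain i where i: "u = y ^ i" "i < n" by auto
      from r show ?case
      proof (induction rule: span_induct)
        case base
        show ?case
          unfolding subspace_def
          by (auto simp: distrib_right mult.assoc intro: span_zero span_add span_scale)
      next
        case (step b)
        thus ?case using i by (auto simp: B'_def intro!: span_base)
      qed
    qed
    hence mem: "r * y ^ k \<in> span B'" if "r \<in> span B" for r k
      using pow that by blast
    have one: "1 \<in> span B"
      using rat_subalgebra_int[OF B(3), of 1] by simp
    \<comment> \<open>Two nested span inductions reduce to products of generators, where
      \<open>mem\<close> brings the exponent \<open>i + j\<close> back below
      \<open>n\<close>.\<close>
    have mult: "u * v \<in> span B'" if u: "u \<in> span B'" and v: "v \<in> span B'" for u v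
      using u
    proof (induction rule: span_induct)
      case base
      show ?case
        unfolding subspace_def
        by (auto simp: distrib_right mult.assoc intro: span_zero span_add span_scale)
    next
      case (step u)
      then obtain b i where bi: "u = b * y ^ i" "b \<in> B" by (auto simp: B'_def)
      from v show ?case
      proof (induction rule: span_induct)
        case base
        show ?case
          unfolding subspace_def
          by (auto simp: distrib_left intro: span_zero span_add scale_right)
      next
        case (step v)
        then obtain c j where cj: "v = c * y ^ j" "c \<in> B" by (auto simp: B'_def)
        have "(b * c) * y ^ (i + j) \<in> span B'"
          using bi(2) cj(2) by (intro mem rat_subalgebra_mult[OF B(3)] span_base)
        thus ?case by (simp add: bi cj power_add mult_ac)
      qed
    qed
    have sub: "span B \<subseteq> span B'"
      using mem[of _ 0] by auto
    show ?case
    proof (intro exI[of _ B'] conjI)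
      show "finite B'" using B(1) by (simp add: B'_def)
      show "insert y S \<subseteq> span B'"
        using mem[OF one, of 1] B(2) sub by auto
      show "rat_subalgebra (span B')"
        unfolding rat_subalgebra_def
        using rat_subalgebra_rat[OF B(3)] sub mult span_add by blast
    qed
  qed
qed

section \<open>Orthogonal expansion in an anisotropic lattice\<close>

text \<open>Orthogonal anisotropic vectors are independent, so an orthogonal set of greatest size
  exists. The component of \<open>v\<close> orthogonal to it must vanish, since otherwise it could
  be added to the set.\<close>

lemma orthogonal_expansion:
  fixes scale :: "'k::field_char_0 \<Rightarrow> 'v::ab_group_add \<Rightarrow> 'v"
  assumes V: "finite_dim_vector_space scale"
    and Q: "quadratic_map scale Q"
    and zero: "0 \<in> L" and add: "\<And>v w. v \<in> L \<Longrightarrow> w \<in> L \<Longrightarrow> v + w \<in> L"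
    and scale: "\<And>a v. algebraic_int a \<Longrightarrow> v \<in> L \<Longrightarrow> scale a v \<in> L"
    and int: "\<And>v. v \<in> L \<Longrightarrow> algebraic_int (Q v)"
    and anisotropic: "\<And>v. v \<in> L \<Longrightarrow> v \<noteq> 0 \<Longrightarrow> Q v \<noteq> 0"
  shows "\<exists>E. finite E \<and> E \<subseteq> L - {0} \<and> (\<forall>v\<in>L. Q v = (\<Sum>e\<in>E. (polar_form Q v e)\<^sup>2 / Q e))"
proof -
  obtain S where S: "finite S" "module.span scale S = UNIV"
    and vs: "vector_space scale"
    using V by (auto simp: finite_dim_vector_space_def)
  interpret vector_space scale by fact
  define B where "B = polar_form Q"
  have lin: "Vector_Spaces.linear scale (*) (\<lambda>v. B v w)" for w
    using Q by (simp add: quadratic_map_def B_def)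
  have B_add: "B (v + w) u = B v u + B w u" and B_diff: "B (v - w) u = B v u - B w u"
    and B_scale: "B (scale a v) u = a * B v u" and B_0: "B 0 u = 0"
    and B_sum: "B (sum f I) u = (\<Sum>i\<in>I. B (f i) u)" for v w u a and f :: "'v \<Rightarrow> 'v" and I
  proof -
    interpret f: Vector_Spaces.linear scale "(*)" "\<lambda>v. B v u" by (rule lin)
    show "B (v + w) u = B v u + B w u" "B (v - w) u = B v u - B w u"
      "B (scale a v) u = a * B v u" "B 0 u = 0" "B (sum f I) u = (\<Sum>i\<in>I. B (f i) u)"
      by (rule f.add f.diff f.scale f.zero f.sum)+
  qed
  have B_sym: "B v w = B w v" for v w
    by (simp add: B_def polar_form_def add.commute)
  \<comment> \<open>Comparing Q(v + v) with 4 Q(v) shows that the polar form recovers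
    \<open>Q\<close> on the diagonal.\<close>
  have "scale 2 v = v + v" for v
    using scale_left_distrib[of 1 1 v] by simp
  moreover have "Q (scale 2 v) = 2\<^sup>2 * Q v" for v
    using Q by (simp add: quadratic_map_def)
  ultimately have B_self: "B v v = Q v" for v
    by (simp add: B_def polar_form_def)
  \<comment> \<open>\<open>B\<close> may be only half-integral; twice \<open>B\<close> is an integer
    combination of values of \<open>Q\<close>.\<close>
  have B_int: "algebraic_int (2 * B v w)" if "v \<in> L" "w \<in> L" for v w
  proof -
    have "algebraic_int (Q (v + w) + (- Q v + - Q w))"
      using that by (intro algebraic_int_plus algebraic_int_minus int add)
    also have "Q (v + w) + (- Q v + - Q w) = 2 * B v w"
      by (simp add: B_def polar_form_def)
    finally show ?thesis .
  qed
  have L_diff: "v - w \<in> L" if "v \<in> L" "w \<in> L" for v w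
    using add[OF that(1) scale[OF _ that(2), of "-1"]] by simp
  have L_sum: "sum f I \<in> L" if "\<And>i. i \<in> I \<Longrightarrow> f i \<in> L" for f :: "'v \<Rightarrow> 'v" and I
    using that by (induction I rule: infinite_finite_induct) (auto simp: zero intro: add)
  have prod_int: "algebraic_int (prod f I)" if "\<And>i. i \<in> I \<Longrightarrow> algebraic_int (f i)"
    for f :: "'v \<Rightarrow> 'k" and I
    using that by (induction I rule: infinite_finite_induct) (auto intro: algebraic_int_times)
  define orth where "orth = (\<lambda>E. finite E \<and> E \<subseteq> L - {0} \<and> (\<forall>e\<in>E. \<forall>f\<in>E. e \<noteq> f \<longrightarrow> B e f = 0))"
  have pair: "B (\<Sum>e\<in>E. scale (c e) e) f = c f * Q f" if "orth E" "f \<in> E" for E f c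
  proof -
    have "B (\<Sum>e\<in>E. scale (c e) e) f = (\<Sum>e\<in>E. if e = f then c f * Q f else 0)"
      unfolding B_sum using that by (intro sum.cong) (auto simp: B_scale orth_def B_self)
    thus ?thesis using that by (simp add: orth_def)
  qed
  have bound: "card E \<le> card S" if E: "orth E" for E
  proof -
    have "independent E"
    proof (rule independent_if_scalars_zero)
      fix c f assume "(\<Sum>e\<in>E. scale (c e) e) = 0" "f \<in> E"
      with pair[OF E, of f c] have "c f * Q f = 0" by (simp add: B_0)
      with anisotropic[of f] E \<open>f \<in> E\<close> show "c f = 0" by (auto simp: orth_def)
    qed (use E in \<open>simp add: orth_def\<close>)
    thus ?thesis
      using independent_span_bound[OF S(1)] S(2) by auto
  qed
  have "orth {}" by (simp add: orth_def)
  then obtain E where E: "orth E" and max: "\<And>F. orth F \<Longrightarrow> card F \<le> card E"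
    using ex_has_greatest_nat[of orth "{}" card "Suc (card S)"] bound by (auto simp: less_Suc_eq_le)
  have fin: "finite E" and EL: "E \<subseteq> L" and Q0: "\<And>e. e \<in> E \<Longrightarrow> Q e \<noteq> 0"
    using E anisotropic by (auto simp: orth_def)
  have "Q v = (\<Sum>e\<in>E. (B v e)\<^sup>2 / Q e)" if v: "v \<in> L" for v
  proof -
    define D where "D = prod Q E"
    \<comment> \<open>This is \<open>2 * D\<close> times the projection coefficient
      \<open>B v e / Q e\<close>, so that no denominators remain.\<close>
    define c where "c = (\<lambda>e. 2 * B v e * prod Q (E - {e}))"
    \<comment> \<open>The component of \<open>v\<close> orthogonal to \<open>E\<close>, multiplied by \<open>2 * D\<close> to land in \<open>L\<close>.\<close>
    define u where "u = scale (2 * D) v - (\<Sum>e\<in>E. scale (c e) e)"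
    have D: "D = Q e * prod Q (E - {e})" if "e \<in> E" for e
      unfolding D_def using fin that by (rule prod.remove)
    have "D \<noteq> 0" using Q0 fin by (simp add: D_def)
    have "u \<in> L"
      unfolding u_def D_def c_def using v EL
      by (intro L_diff L_sum scale algebraic_int_times prod_int B_int int algebraic_int_numeral) auto
    have uE: "B u f = 0" if "f \<in> E" for f
      using D[OF that] by (simp add: u_def B_diff B_scale pair[OF E that] c_def)
    have "u = 0"
    proof (rule ccontr)
      assume "u \<noteq> 0"
      with \<open>u \<in> L\<close> have "B u u \<noteq> 0" using anisotropic B_self by simp
      hence "u \<notin> E" using uE by auto
      moreover have "orth (insert u E)"
        using E uE \<open>u \<in> L\<close> \<open>u \<noteq> 0\<close> B_sym by (auto simp: orth_def)
      ultimately show False using max[of "insert u E"] fin by simp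
    qed
    \<comment> \<open>Pairing the vanishing \<open>u\<close> with \<open>v\<close> yields
      \<open>2 * D\<close> times the claimed identity.\<close>
    hence "0 = B u v" by (simp add: B_0)
    also have "\<dots> = 2 * D * Q v - (\<Sum>e\<in>E. c e * B v e)"
      by (simp add: u_def B_diff B_scale B_sum B_self, simp add: B_sym[of _ v])
    also have "(\<Sum>e\<in>E. c e * B v e) = 2 * D * (\<Sum>e\<in>E. (B v e)\<^sup>2 / Q e)"
      unfolding sum_distrib_left using Q0 by (intro sum.cong) (auto simp: c_def D power2_eq_square)
    finally show ?thesis
      using \<open>D \<noteq> 0\<close> by simp
  qed
  with E show ?thesis by (auto simp: orth_def B_def)
qed

section \<open>Houses in totally real fields\<close>

lemma embedding_real_part:
  fixes x :: "'k::field_char_0"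
  assumes "field_hom (\<phi> :: 'k \<Rightarrow> complex)" "totally_real x"
  shows "\<phi> x = of_real (Re (\<phi> x))" "\<bar>Re (\<phi> x)\<bar> \<le> house x"
    "totally_positive x \<Longrightarrow> Re (\<phi> x) > 0"
proof -
  have x: "algebraic x" "conjugates x \<subseteq> \<real>"
    using assms(2) by (auto simp: totally_real_def)
  have conj: "\<phi> x \<in> conjugates x"
    by (rule embedding_in_conjugates[OF assms(1) x(1)])
  with x(2) show "\<phi> x = of_real (Re (\<phi> x))" by auto
  show "\<bar>Re (\<phi> x)\<bar> \<le> house x"
    using norm_le_house[OF x(1) conj] abs_Re_le_cmod[of "\<phi> x"] by linarith
  show "Re (\<phi> x) > 0" if "totally_positive x"
    using that conj by (auto simp: totally_positive_def)
qed

lemma house_nonneg: "algebraic x \<Longrightarrow> house x \<ge> 0"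
  using conjugates_nonempty norm_le_house norm_ge_zero order.trans by blast

text \<open>Under each embedding the summands are nonnegative reals, so the one at \<open>f\<close>
  is at most the image of \<alpha>. Every conjugate of \<open>2 * b f\<close> arises from an
  embedding, which turns this into a bound on the house.\<close>

lemma house_le_sqrt_of_weighted_squares:
  fixes b q :: "'i \<Rightarrow> 'k::field_char_0"
  assumes real: "\<And>x::'k. totally_real x" and fin: "finite E" and f: "f \<in> E"
    and q: "\<And>e. e \<in> E \<Longrightarrow> totally_positive (q e)"
    and \<alpha>: "\<alpha> = (\<Sum>e\<in>E. (b e)\<^sup>2 / q e)"
  shows "house (2 * b f) \<le> 2 * sqrt (house \<alpha> * house (q f))"
proof -
  have alg: "algebraic x" for x :: 'k
    using real by (simp add: totally_real_def)
  show ?thesis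
    unfolding house_le_iff[OF alg]
  proof
    fix z assume "z \<in> conjugates (2 * b f)"
    then obtain \<phi> :: "'k \<Rightarrow> complex" where \<phi>: "field_hom \<phi>" "\<phi> (2 * b f) = z"
      using conjugate_embedding[OF alg] by blast
    interpret field_hom \<phi> by fact
    define r where "r = (\<lambda>x. Re (\<phi> x))"
    have \<phi>r: "\<phi> x = of_real (r x)" and r_le: "\<bar>r x\<bar> \<le> house x" for x
      using embedding_real_part(1,2)[OF \<phi>(1) real] by (simp_all add: r_def)
    have r_pos: "r (q e) > 0" if "e \<in> E" for e
      using embedding_real_part(3)[OF \<phi>(1) real q[OF that]] by (simp add: r_def)
    have "\<phi> \<alpha> = (\<Sum>e\<in>E. (\<phi> (b e))\<^sup>2 / \<phi> (q e))"
      unfolding \<alpha> by (simp add: hom_sum hom_div hom_power)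
    hence "complex_of_real (r \<alpha>) = of_real (\<Sum>e\<in>E. (r (b e))\<^sup>2 / r (q e))"
      by (simp add: \<phi>r)
    hence "r \<alpha> = (\<Sum>e\<in>E. (r (b e))\<^sup>2 / r (q e))"
      by (simp only: of_real_eq_iff)
    moreover have "(r (b f))\<^sup>2 / r (q f) \<le> (\<Sum>e\<in>E. (r (b e))\<^sup>2 / r (q e))"
      using fin f r_pos by (intro member_le_sum) (auto intro!: divide_nonneg_pos)
    ultimately have "(r (b f))\<^sup>2 \<le> r \<alpha> * r (q f)"
      using r_pos[OF f] by (simp add: field_simps)
    also have "\<dots> \<le> house \<alpha> * house (q f)"
      using r_le[of \<alpha>] r_le[of "q f"] r_pos[OF f] house_nonneg[OF alg, of \<alpha>]
      by (intro mult_mono) auto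
    finally have "\<bar>r (b f)\<bar> \<le> sqrt (house \<alpha> * house (q f))"
      using real_sqrt_le_mono by fastforce
    moreover have "\<phi> 2 = 2"
      using hom_add[of 1 1] by simp
    hence "z = 2 * of_real (r (b f))"
      using \<phi>(2) by (simp add: hom_mult \<phi>r[of "b f"])
    ultimately show "norm z \<le> 2 * sqrt (house \<alpha> * house (q f))"
      by (simp add: norm_mult)
  qed
qed

lemma algebraic_int_shift_totally_positive:
  fixes z :: "'k::field_char_0"
  assumes real: "\<And>x::'k. totally_real x" and z: "algebraic_int z"
  shows "\<exists>N::nat. z + of_nat N \<in> totally_positive_integers \<and> house (z + of_nat N) \<le> 2 * house z + 1"
proof -
  have alg: "algebraic x" for x :: 'k
    using real by (simp add: totally_real_def)
  \<comment> \<open>Floor plus one instead of the ceiling, so that \<open>N\<close> exceeds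
    \<open>house z\<close> strictly even if that is an integer; every conjugate then becomes
    positive.\<close>
  define N where "N = nat \<lfloor>house z\<rfloor> + 1"
  have N: "house z < real N" "real N \<le> house z + 1"
    using house_nonneg[OF alg, of z] by (auto simp: N_def) linarith+
  have conj: "w \<in> \<real> \<and> Re w > 0 \<and> norm w \<le> 2 * house z + 1"
    if w: "w \<in> conjugates (z + of_nat N)" for w
  proof -
    obtain \<phi> :: "'k \<Rightarrow> complex" where \<phi>: "field_hom \<phi>" "\<phi> (z + of_nat N) = w"
      using conjugate_embedding[OF alg w] by blast
    interpret field_hom \<phi> by fact
    have "\<phi> (of_nat n) = of_nat n" for n
      by (induction n) (simp_all add: hom_add)
    hence "w = of_real (Re (\<phi> z) + real N)"
      using \<phi>(2) embedding_real_part(1)[OF \<phi>(1) real, of z] by (simp add: hom_add)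
    moreover have "\<bar>Re (\<phi> z)\<bar> \<le> house z"
      by (rule embedding_real_part(2)[OF \<phi>(1) real])
    ultimately show ?thesis
      using N by (auto simp del: of_real_add)
  qed
  have "algebraic_int (z + of_nat N)"
    by (intro algebraic_int_plus z int_imp_algebraic_int) auto
  with conj have "z + of_nat N \<in> totally_positive_integers"
    by (auto simp: totally_positive_integers_def ring_of_integers_def totally_positive_def alg)
  moreover have "house (z + of_nat N) \<le> 2 * house z + 1"
    using conj house_le_iff[OF alg] by blast
  ultimately show ?thesis by blast
qed

text \<open>An element outside \<open>R\<close> is made integral by an integer factor and totally
  positive by an integer shift; both operations can be undone inside \<open>R\<close>.\<close>

lemma totally_positive_integer_notin:
  fixes R :: "'k::field_char_0 set"
  assumes real: "\<And>x::'k. totally_real x" and R: "rat_subalgebra R" "R \<noteq> UNIV"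
  shows "\<exists>x\<in>totally_positive_integers. x \<notin> R"
proof -
  obtain y where y: "y \<notin> R" using R(2) by blast
  obtain c where c: "c \<noteq> 0" "algebraic_int (of_int c * y)"
    using algebraic_imp_multiple_algebraic_int[of y] real[of y] by (auto simp: totally_real_def)
  obtain N where N: "of_int c * y + of_nat N \<in> totally_positive_integers"
    using algebraic_int_shift_totally_positive[OF real c(2)] by blast
  have "of_int c * y + of_nat N \<notin> R"
  proof
    assume "of_int c * y + of_nat N \<in> R"
    hence "of_rat (inverse (of_int c)) * ((of_int c * y + of_nat N) + of_int (- int N)) \<in> R"
      by (rule rat_subalgebra_mult[OF R(1) rat_subalgebra_rat[OF R(1)]
          rat_subalgebra_add[OF R(1) _ rat_subalgebra_int[OF R(1)]]])
    with c(1) y show False by (simp add: of_rat_inverse flip: mult.assoc)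
  qed
  with N show ?thesis by blast
qed

lemma northcott_house_minimal:
  assumes "northcott_house A" "x \<in> A"
  shows "\<exists>m\<in>A. \<forall>y\<in>A. house m \<le> house y"
proof -
  \<comment> \<open>The \<open>+ 1\<close> puts \<open>x\<close> itself into \<open>T\<close>, so a
    minimum over this finite set is a minimum over \<open>A\<close>.\<close>
  define T where "T = {y \<in> A. house y < house x + 1}"
  have T: "finite T" "x \<in> T"
    using assms by (auto simp: northcott_house_def T_def)
  then obtain m where m: "m \<in> T" "\<forall>y\<in>T. house m \<le> house y"
    using ex_min_if_finite[of "house ` T"] by (auto simp: not_less)
  show ?thesis
  proof (intro bexI ballI)
    show "m \<in> A" using m by (simp add: T_def)
    fix y assume "y \<in> A"
    with m T(2) show "house m \<le> house y" by (force simp: T_def)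
  qed
qed

section \<open>Universal lattices and the totally positive integer of minimal house\<close>

theorem theorem1p2:
  assumes totally_real_K: "\<forall>x::'k::field_char_0. totally_real x"
    and infinite_degree: "infinite_degree_over_rat TYPE('k)"
    and northcott: "northcott_house (totally_positive_integers :: 'k set)"
  shows "\<not> (\<exists>(scale :: 'k \<Rightarrow> 'v::ab_group_add \<Rightarrow> 'v) L q. universal_quadratic_lattice scale L q)"
proof (rule notI, elim exE)
  fix scale :: "'k \<Rightarrow> 'v \<Rightarrow> 'v" and L q
  assume univ: "universal_quadratic_lattice scale L q"
  have real: "totally_real x" and alg: "algebraic x" for x :: 'k
    using totally_real_K by (auto simp: totally_real_def)
  note defs = universal_quadratic_lattice_def positive_definite_lattice_def
    integral_quadratic_lattice_def quadratic_lattice_def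
  obtain Q where Q: "quadratic_map scale Q" "\<And>v. v \<in> L \<Longrightarrow> q v = Q v"
    using univ unfolding defs by blast
  have int: "algebraic_int (Q v)" and pos: "v \<noteq> 0 \<Longrightarrow> totally_positive (Q v)"
    if "v \<in> L" for v
    using univ Q(2) that unfolding defs by (auto simp: ring_of_integers_def)
  have represented: "\<exists>v\<in>L. Q v = d" if "d \<in> totally_positive_integers" for d
    using univ Q(2) that unfolding defs by metis
  have L: "finite_dim_vector_space scale" "integer_lattice scale L"
    using univ unfolding defs by auto
  have zero: "0 \<in> L" and add: "v \<in> L \<Longrightarrow> w \<in> L \<Longrightarrow> v + w \<in> L" for v w
    using L(2) by (auto simp: integer_lattice_def)
  have "\<exists>E. finite E \<and> E \<subseteq> L - {0} \<and>
      (\<forall>v\<in>L. Q v = (\<Sum>e\<in>E. (polar_form Q v e)\<^sup>2 / Q e))"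
  proof (rule orthogonal_expansion[OF L(1) Q(1) zero add _ int])
    show "scale a v \<in> L" if "algebraic_int a" "v \<in> L" for a v
      using L(2) that by (auto simp: integer_lattice_def ring_of_integers_def)
    \<comment> \<open>Zero is its own conjugate and hence not totally positive, so positive
      definiteness gives anisotropy.\<close>
    have "0 \<in> conjugates (0 :: 'k)"
      by (simp add: conjugates_eq_roots[OF alg] poly_0_coeff_0 coeff_map_poly)
    hence "\<not> totally_positive (0 :: 'k)"
      by (auto simp: totally_positive_def intro!: bexI[of _ 0])
    thus "Q v \<noteq> 0" if "v \<in> L" "v \<noteq> 0" for v
      using pos[OF that] by auto
  qed auto
  then obtain E where E: "finite E" "E \<subseteq> L - {0}"
    and expand: "\<And>v. v \<in> L \<Longrightarrow> Q v = (\<Sum>e\<in>E. (polar_form Q v e)\<^sup>2 / Q e)"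
    by blast
  \<comment> \<open>The inserted 1 handles empty \<open>E\<close> and ensures h \<ge> 36 later
    on.\<close>
  define C where "C = Max (insert 1 (house ` Q ` E))"
  have C: "1 \<le> C" "\<And>e. e \<in> E \<Longrightarrow> house (Q e) \<le> C"
    using E(1) by (auto simp: C_def)
  \<comment> \<open>The factor 36 makes sqrt (h C) \<le> h / 6 whenever h \<ge> 36 C.\<close>
  define S where "S = Q ` E \<union> {x \<in> totally_positive_integers. house x < 36 * C}"
  have "finite S"
    using E(1) northcott by (auto simp: S_def northcott_house_def)
  \<comment> \<open>The finite set \<open>S\<close> generates an algebra of finite dimension over
    the rationals, which is proper because the degree of \<open>'k\<close> is infinite.\<close>
  then obtain R where R: "rat_subalgebra R" "S \<subseteq> R" "R \<noteq> UNIV"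
    using finite_dim_rat_subalgebra[of S] alg infinite_degree
    unfolding infinite_degree_over_rat_def by metis
  define A where "A = {x \<in> totally_positive_integers. x \<notin> R}"
  have "northcott_house A"
    unfolding northcott_house_def
  proof
    fix r
    have "finite {x \<in> totally_positive_integers :: 'k set. house x < r}"
      using northcott by (simp add: northcott_house_def)
    thus "finite {x \<in> A. house x < r}"
      by (rule rev_finite_subset) (auto simp: A_def)
  qed
  moreover obtain x where "x \<in> A"
    using totally_positive_integer_notin[OF real R(1,3)] by (auto simp: A_def)
  ultimately obtain \<alpha> where \<alpha>: "\<alpha> \<in> A" and min: "\<And>y. y \<in> A \<Longrightarrow> house \<alpha> \<le> house y"
    using northcott_house_minimal by metis
  define h where "h = house \<alpha>"
  have h: "36 * C \<le> h"
  proof (rule ccontr)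
    assume "\<not> 36 * C \<le> h"
    with \<alpha> have "\<alpha> \<in> S" by (auto simp: S_def A_def h_def)
    with \<alpha> R(2) show False by (auto simp: A_def)
  qed
  obtain v where v: "v \<in> L" "Q v = \<alpha>"
    using represented \<alpha> by (auto simp: A_def)
  \<comment> \<open>Otherwise the expansion of \<open>Q v\<close> would lie in \<open>R\<close>,
    which contains all \<open>Q e\<close> and their inverses, and so would \<alpha>.\<close>
  have "\<exists>e\<in>E. polar_form Q v e \<notin> R"
  proof (rule ccontr)
    assume *: "\<not> (\<exists>e\<in>E. polar_form Q v e \<notin> R)"
    have "(\<Sum>e\<in>E. polar_form Q v e * polar_form Q v e * inverse (Q e)) \<in> R"
      using * R(2)
      by (intro rat_subalgebra_sum[OF R(1)] rat_subalgebra_mult[OF R(1)]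
          rat_subalgebra_inverse[OF R(1)] alg) (auto simp: S_def)
    moreover have "\<alpha> = (\<Sum>e\<in>E. polar_form Q v e * polar_form Q v e * inverse (Q e))"
      using expand[OF v(1)] v(2) by (simp add: power2_eq_square divide_inverse)
    ultimately show False using \<alpha> by (simp add: A_def)
  qed
  then obtain f where f: "f \<in> E" "polar_form Q v f \<notin> R" by blast
  define b where "b = 2 * polar_form Q v f"
  have "f \<in> L" using f E by auto
  hence "algebraic_int (Q (v + f) + (- Q v + - Q f))"
    using v(1) by (intro algebraic_int_plus algebraic_int_minus int add)
  also have "Q (v + f) + (- Q v + - Q f) = b"
    by (simp add: b_def polar_form_def)
  finally have "algebraic_int b" .
  then obtain N where N: "b + of_nat N \<in> totally_positive_integers"
    "house (b + of_nat N) \<le> 2 * house b + 1"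
    using algebraic_int_shift_totally_positive[OF real] by blast
  have "b + of_nat N \<notin> R"
  proof
    assume "b + of_nat N \<in> R"
    hence "of_rat (1 / 2) * ((b + of_nat N) + of_int (- int N)) \<in> R"
      by (rule rat_subalgebra_mult[OF R(1) rat_subalgebra_rat[OF R(1)]
          rat_subalgebra_add[OF R(1) _ rat_subalgebra_int[OF R(1)]]])
    with f(2) show False by (simp add: b_def of_rat_divide)
  qed
  with N(1) have "h \<le> house (b + of_nat N)"
    using min by (simp add: A_def h_def)
  also have "\<dots> \<le> 2 * house b + 1" by (rule N(2))
  also have "house b \<le> 2 * sqrt (h * house (Q f))"
    unfolding b_def h_def
  proof (rule house_le_sqrt_of_weighted_squares[where q = Q, OF real E(1) f(1)])
    show "totally_positive (Q e)" if "e \<in> E" for e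
      using that E(2) by (intro pos) auto
    show "\<alpha> = (\<Sum>e\<in>E. (polar_form Q v e)\<^sup>2 / Q e)"
      using expand[OF v(1)] v(2) by simp
  qed
  also have "\<dots> \<le> 2 * sqrt (h * C)"
    using C(2)[OF f(1)] h C(1) by (intro mult_left_mono real_sqrt_le_mono) auto
  also have "sqrt (h * C) \<le> h / 6"
  proof (rule real_le_lsqrt)
    show "h * C \<le> (h / 6)\<^sup>2"
      using h C(1) mult_left_mono[OF h, of h] by (simp add: power2_eq_square)
  qed (use h C(1) in auto)
  \<comment> \<open>The chain gives h \<le> 2 h / 3 + 1, that is h \<le> 3, against h \<ge>
    36.\<close>
  finally show False using h C(1) by simp
qed

end
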